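(* Let $n\ge 1$ and let $\mathcal F$ be a nonempty family of subsets of $[n]=\{1,\dots,n\}$ that is union-closed (i.e. $S\cup T\in\mathcal F$ whenever $S,T\in\mathcal F$). Then there exists $i\in[n]$ such that $|\{S\in\mathcal F: i\in S\}| \ge \frac{3-\sqrt5}{2}\,|\mathcal F|$.
   Formalization: The formal theorem additionally assumes that the family is not the one whose only member is the empty set; for that family the stated claim is false, since no i lies in any member. *)

theory Defs
  imports Complex_Main
begin

definition union_closed :: "'a set set \<Rightarrow> bool" where
  "union_closed F \<longleftrightarrow> (\<forall>S\<in>F. \<forall>T\<in>F. S \<union> T \<in> F)"

end

theory Submission
  imports Defs "HOL-Analysis.Analysis" "HOL-Real_Asymp.Real_Asymp"
begin

text \<open>
  The entropy method of Gilmer with the sharp constant of Alweiss--Huang--Sellke, Chase--Lovett,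
  Pebody and Sawin. Let \<open>A\<close>, \<open>B\<close> be independent and uniform on the family \<open>F\<close>, put
  \<open>\<phi> = (sqrt 5 - 1) / 2\<close>, and let \<open>h\<close> be the binary entropy. The inequality
  \<open>x h(y) + y h(x) \<le> 2 \<phi> h(x y)\<close>, applied to the conditional probabilities that \<open>A\<close> and \<open>B\<close> avoid
  the next element given their earlier elements, shows that each new element contributes at least
  \<open>P(i \<notin> A) / \<phi>\<close> times as much entropy to \<open>A \<union> B\<close> as it does to \<open>A\<close>. If every element were
  avoided with probability larger than \<open>\<phi>\<close>, then \<open>A \<union> B\<close> would have more entropy than the uniform
  distribution on \<open>F\<close>, although \<open>A \<union> B \<in> F\<close>.

  With \<open>G(x) = h(x) / x\<close>, the function \<open>s \<mapsto> G(exp (- s))\<close> is concave, which reduces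
  the inequality to its diagonal case \<open>G(x) \<le> \<phi> G(x\<^sup>2)\<close>. The latter has equality at \<open>x = \<phi>\<close> and
  \<open>x = 1\<close>, and it follows from the sign pattern of the derivative of \<open>\<phi> G(x\<^sup>2) - G(x)\<close>.
\<close>

subsection \<open>An inequality for the binary entropy\<close>

text \<open>The positive root of \<open>x\<^sup>2 + x = 1\<close>; the constant
  \<open>(3 - sqrt 5) / 2\<close> is \<open>1 - gold\<close>.\<close>

definition gold :: real where
  "gold = (sqrt 5 - 1) / 2"

lemma gold_sq: "gold\<^sup>2 = 1 - gold"
  by (simp add: gold_def power2_eq_square field_simps)

text \<open>The lower bound gives \<open>1 < 2 * gold\<close>; the upper one decides the sign of
  \<open>gap_cubic gold\<close>, which equals \<open>7 - 11 * gold\<close>.\<close>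

lemma gold_bounds: "3 / 5 < gold" "gold < 7 / 11"
proof -
  have "11 / 5 < sqrt 5" "sqrt 5 < 25 / 11"
    by (rule real_less_rsqrt real_less_lsqrt; simp add: power2_eq_square)+
  then show "3 / 5 < gold" "gold < 7 / 11"
    by (simp_all add: gold_def)
qed

section \<open>Binary entropy in nats and the ratio G(x)\<close>

definition bin_ent :: "real \<Rightarrow> real" where
  "bin_ent x = - (x * ln x + (1 - x) * ln (1 - x))"

lemma bin_ent_0 [simp]: "bin_ent 0 = 0" and bin_ent_1 [simp]: "bin_ent 1 = 0"
  by (simp_all add: bin_ent_def)

lemma bin_ent_nonneg: "0 \<le> x \<Longrightarrow> x \<le> 1 \<Longrightarrow> 0 \<le> bin_ent x"
proof -
  assume x: "0 \<le> x" "x \<le> 1"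
  have "x * ln x \<le> 0" "(1 - x) * ln (1 - x) \<le> 0"
    using x by (cases "x = 0"; cases "x = 1"; simp add: mult_nonneg_nonpos)+
  then show ?thesis by (simp add: bin_ent_def)
qed

text \<open>In the quotient rule all terms with \<open>ln x\<close> cancel.\<close>

lemma bin_ent_ratio_deriv:
  assumes "0 < x" "x < 1"
  shows "((\<lambda>x. bin_ent x / x) has_real_derivative ln (1 - x) / x\<^sup>2) (at x)"
proof -
  have "(bin_ent has_real_derivative
      - (1 * ln x + (1 / x) * x + ((0 - 1) * ln (1 - x) + (1 / (1 - x) * (0 - 1)) * (1 - x)))) (at x)"
    unfolding bin_ent_def using assms by (auto intro!: derivative_eq_intros)
  then have "(bin_ent has_real_derivative ln (1 - x) - ln x) (at x)"
    using assms by simp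
  then have "((\<lambda>x. bin_ent x / x) has_real_derivative ((ln (1 - x) - ln x) * x - bin_ent x * 1) / (x * x)) (at x)"
    using assms by (intro DERIV_divide DERIV_ident) auto
  moreover have "(ln (1 - x) - ln x) * x - bin_ent x * 1 = ln (1 - x)"
    by (simp add: bin_ent_def algebra_simps)
  ultimately show ?thesis by (simp add: power2_eq_square)
qed

text \<open>At \<open>x = exp (- s)\<close> this quotient is the derivative in \<open>s\<close> of
  -G(x), so its monotonicity yields the concavity below. The sign of its own derivative comes from
  \<open>ln t \<le> t - 1\<close> at \<open>t = 1 / (1 - z)\<close>.\<close>

lemma ln_one_minus_div_antimono:
  assumes "0 < x" "x \<le> y" "y < (1::real)"
  shows "ln (1 - y) / y \<le> ln (1 - x) / x"
proof (rule DERIV_nonpos_imp_nonincreasing [OF assms(2)])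
  fix z assume z: "x \<le> z" "z \<le> y"
  then have z01: "0 < z" "z < 1" using assms by auto
  have "ln (1 / (1 - z)) \<le> 1 / (1 - z) - 1"
    using z01 by (intro ln_le_minus_one) auto
  also have "\<dots> = z / (1 - z)" using z01 by (simp add: field_simps)
  finally have "- ln (1 - z) \<le> z / (1 - z)"
    using z01 by (simp add: ln_div)
  then have "(- (z / (1 - z)) - ln (1 - z)) / z\<^sup>2 \<le> 0"
    using z01 by (intro divide_nonpos_pos) auto
  moreover have "((\<lambda>z. ln (1 - z) / z) has_real_derivative (- (z / (1 - z)) - ln (1 - z)) / z\<^sup>2) (at z)"
    using z01 by (auto intro!: derivative_eq_intros simp: field_simps power2_eq_square)
  ultimately show "\<exists>d. ((\<lambda>z. ln (1 - z) / z) has_real_derivative d) (at z) \<and> d \<le> 0" by blast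
qed

lemma convex_neg_bin_ent_ratio_exp: "convex_on {0<..} (\<lambda>s. - (bin_ent (exp (- s)) / exp (- s)))"
proof (rule convex_on_realI)
  show "connected {0::real<..}" by simp
next
  fix s :: real assume s: "s \<in> {0<..}"
  have "((\<lambda>s. bin_ent (exp (- s)) / exp (- s)) has_real_derivative
      ln (1 - exp (- s)) / (exp (- s))\<^sup>2 * (- exp (- s))) (at s)"
    using s by (intro DERIV_chain2 [OF bin_ent_ratio_deriv]) (auto intro!: derivative_eq_intros)
  from DERIV_minus [OF this]
  show "((\<lambda>s. - (bin_ent (exp (- s)) / exp (- s))) has_real_derivative
      ln (1 - exp (- s)) / exp (- s)) (at s)"
    by (simp add: power2_eq_square)
next
  fix s t :: real assume "s \<in> {0<..}" "t \<in> {0<..}" "s \<le> t"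
  then show "ln (1 - exp (- s)) / exp (- s) \<le> ln (1 - exp (- t)) / exp (- t)"
    by (intro ln_one_minus_div_antimono) auto
qed

text \<open>Midpoint concavity at \<open>- ln x\<close> and \<open>- ln y\<close>: averaging
  logarithms produces the geometric mean.\<close>

lemma bin_ent_ratio_geometric_mean:
  assumes "0 < x" "x < 1" "0 < y" "y < 1"
  shows "bin_ent x / x + bin_ent y / y \<le> 2 * (bin_ent (sqrt (x * y)) / sqrt (x * y))"
proof -
  define g where "g s = - (bin_ent (exp (- s)) / exp (- s))" for s :: real
  have "g ((1 - 1/2) *\<^sub>R (- ln x) + (1/2) *\<^sub>R (- ln y)) \<le> (1 - 1/2) * g (- ln x) + 1/2 * g (- ln y)"
    using convex_neg_bin_ent_ratio_exp assms unfolding g_def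
    by (intro convex_onD) auto
  then have "g (- ln x) + g (- ln y) \<ge> 2 * g (- ((ln x + ln y) / 2))"
    by (simp add: algebra_simps add_divide_distrib)
  moreover have "exp ((ln x + ln y) / 2) = sqrt (x * y)"
    using assms by (simp add: powr_half_sqrt [symmetric] powr_def ln_mult)
  ultimately show ?thesis
    using assms by (simp add: g_def)
qed

text \<open>
  The function \<open>gap_numer\<close> is \<open>x ^ 3\<close> times the derivative of \<open>\<phi> G(x\<^sup>2) - G(x)\<close>. Its second
  derivative is \<open>gap_cubic\<close> divided by a square; that cubic is negative, positive, negative on
  the unit interval, so \<open>gap_numer\<close> is concave, convex, concave there.
\<close>

definition gap_numer :: "real \<Rightarrow> real" where
  "gap_numer x = (2 * gold - x) * ln (1 - x) + 2 * gold * ln (1 + x)"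

definition gap_numer' :: "real \<Rightarrow> real" where
  "gap_numer' x = - ln (1 - x) - (2 * gold - x) / (1 - x) + 2 * gold / (1 + x)"

definition gap_cubic :: "real \<Rightarrow> real" where
  "gap_cubic x = - (x ^ 3) - 4 * gold * x\<^sup>2 + 3 * x + (2 - 4 * gold)"

lemma gap_numer_deriv:
  assumes "0 \<le> x" "x < 1"
  shows "(gap_numer has_real_derivative gap_numer' x) (at x)"
proof -
  have "(gap_numer has_real_derivative (0 - 1) * ln (1 - x) + (1 / (1 - x) * (0 - 1)) * (2 * gold - x)
      + 2 * gold * (1 / (1 + x))) (at x)"
    unfolding gap_numer_def using assms by (auto intro!: derivative_eq_intros)
  then show ?thesis by (simp add: gap_numer'_def)
qed

lemma gap_numer'_deriv:
  assumes "0 \<le> x" "x < 1"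
  shows "(gap_numer' has_real_derivative gap_cubic x / ((1 - x)\<^sup>2 * (1 + x)\<^sup>2)) (at x)"
proof -
  have "(gap_numer' has_real_derivative
     1 / (1 - x) - ((- 1) * (1 - x) - (2 * gold - x) * (- 1)) / ((1 - x) * (1 - x))
       - 2 * gold / ((1 + x) * (1 + x))) (at x)"
    unfolding gap_numer'_def using assms
    by (auto intro!: derivative_eq_intros)
  moreover have "1 / (1 - x) - ((- 1) * (1 - x) - (2 * gold - x) * (- 1)) / ((1 - x) * (1 - x))
       - 2 * gold / ((1 + x) * (1 + x)) = gap_cubic x / ((1 - x)\<^sup>2 * (1 + x)\<^sup>2)"
  proof -
    have "1 - x \<noteq> 0" "1 + x \<noteq> 0" using assms by auto
    then show ?thesis
      unfolding gap_cubic_def by (simp add: divide_simps) algebra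
  qed
  ultimately show ?thesis by simp
qed

lemma convex_neg_gap_cubic: "convex_on {0..} (\<lambda>x. - gap_cubic x)"
proof (rule convex_on_realI)
  show "connected {0::real..}" by simp
next
  fix x :: real
  show "((\<lambda>x. - gap_cubic x) has_real_derivative 3 * x\<^sup>2 + 8 * gold * x - 3) (at x)"
    unfolding gap_cubic_def by (auto intro!: derivative_eq_intros)
next
  fix x y :: real assume "x \<in> {0..}" "y \<in> {0..}" "x \<le> y"
  then show "3 * x\<^sup>2 + 8 * gold * x - 3 \<le> 3 * y\<^sup>2 + 8 * gold * y - 3"
    using gold_bounds by (simp add: add_mono power_mono mult_left_mono)
qed

lemma gap_cubic_gold_pos: "0 < gap_cubic gold"
proof -
  have "gold ^ 3 = 2 * gold - 1"
    using gold_sq by algebra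
  then have "gap_cubic gold = 7 - 11 * gold"
    unfolding gap_cubic_def using gold_sq by algebra
  then show ?thesis using gold_bounds by simp
qed

lemma gap_cubic_quasiconcave:
  assumes "0 \<le> x" "x \<le> y" "y \<le> z"
  shows "min (gap_cubic x) (gap_cubic z) \<le> gap_cubic y"
proof -
  have "convex_on {x..z} (\<lambda>x. - gap_cubic x)"
    using convex_neg_gap_cubic by (rule convex_on_subset) (use assms in auto)
  from convex_on_le_max [OF this, of y] show ?thesis
    using assms by auto
qed

text \<open>The cubic is negative at 0 and 1 and positive at \<open>gold\<close>, which gives a root
  on either side of \<open>gold\<close>; quasiconcavity then fixes the sign between and beyond the
  two roots.\<close>

lemma gap_cubic_sign:
  obtains a b where "0 < a" "a < gold" "gold < b" "b < 1"
    "\<And>x. 0 \<le> x \<Longrightarrow> x \<le> a \<Longrightarrow> gap_cubic x \<le> 0"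
    "\<And>x. a \<le> x \<Longrightarrow> x \<le> b \<Longrightarrow> 0 \<le> gap_cubic x"
    "\<And>x. b \<le> x \<Longrightarrow> gap_cubic x \<le> 0"
proof -
  have cont: "continuous_on S gap_cubic" for S
    unfolding gap_cubic_def by (intro continuous_intros)
  have c0: "gap_cubic 0 < 0" and c1: "gap_cubic 1 < 0"
    using gold_bounds by (simp_all add: gap_cubic_def)
  obtain a where a: "0 \<le> a" "a \<le> gold" "gap_cubic a = 0"
    using IVT' [of gap_cubic 0 0 gold] c0 gap_cubic_gold_pos gold_bounds cont by auto
  obtain b where b: "gold \<le> b" "b \<le> 1" "gap_cubic b = 0"
    using IVT2' [of gap_cubic 1 0 gold] c1 gap_cubic_gold_pos gold_bounds cont by auto
  show ?thesis
  proof (rule that [of a b])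
    show "0 < a" "a < gold" "gold < b" "b < 1"
      using a b c0 c1 gap_cubic_gold_pos by (auto simp: less_le)
    show "gap_cubic x \<le> 0" if "0 \<le> x" "x \<le> a" for x
      using gap_cubic_quasiconcave [of x a gold] that a gap_cubic_gold_pos by auto
    show "0 \<le> gap_cubic x" if "a \<le> x" "x \<le> b" for x
      using gap_cubic_quasiconcave [of a x b] that a b by auto
    show "gap_cubic x \<le> 0" if "b \<le> x" for x
      using gap_cubic_quasiconcave [of gold b x] that b gap_cubic_gold_pos gold_bounds by auto
  qed
qed

text \<open>Both logarithms become multiples of \<open>ln gold\<close> and cancel, so
  \<open>gold\<close> is a critical point of \<open>gap\<close>.\<close>

lemma gap_numer_gold: "gap_numer gold = 0"
proof -
  have "1 - gold = gold * gold" "1 + gold = 1 / gold"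
    using gold_sq gold_bounds by (simp_all add: power2_eq_square field_simps)
  then show ?thesis
    using gold_bounds unfolding gap_numer_def by (simp add: ln_mult ln_div)
qed

text \<open>On \<open>{0..a}\<close> both \<open>gap_numer\<close> and \<open>gap_numer'\<close>
  start at 0 and decrease. On \<open>{a..b}\<close> the function is convex, nonpositive at
  \<open>a\<close> and zero at \<open>gold\<close>, so it changes sign only at \<open>gold\<close>.
  Beyond \<open>b\<close> only concavity is recorded; the last sign change is never located.\<close>

lemma gap_numer_sign:
  obtains b where "gold < b" "b < 1"
    "\<And>x. 0 \<le> x \<Longrightarrow> x \<le> gold \<Longrightarrow> gap_numer x \<le> 0"
    "\<And>x. gold \<le> x \<Longrightarrow> x \<le> b \<Longrightarrow> 0 \<le> gap_numer x"
    "convex_on {b..<1} (\<lambda>x. - gap_numer x)"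
proof -
  obtain a b where ab: "0 < a" "a < gold" "gold < b" "b < 1"
    and neg1: "\<And>x. 0 \<le> x \<Longrightarrow> x \<le> a \<Longrightarrow> gap_cubic x \<le> 0"
    and pos: "\<And>x. a \<le> x \<Longrightarrow> x \<le> b \<Longrightarrow> 0 \<le> gap_cubic x"
    and neg2: "\<And>x. b \<le> x \<Longrightarrow> gap_cubic x \<le> 0"
    using gap_cubic_sign by blast
  have a1: "a < 1" using ab by simp
  have deriv_neg: "gap_numer' x \<le> 0" if "0 \<le> x" "x \<le> a" for x
  proof -
    have "gap_numer' x \<le> gap_numer' 0"
    proof (rule DERIV_nonpos_imp_nonincreasing [OF that(1)])
      fix y assume y: "0 \<le> y" "y \<le> x"
      then have "gap_cubic y / ((1 - y)\<^sup>2 * (1 + y)\<^sup>2) \<le> 0"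
        using neg1 that by (intro divide_nonpos_nonneg) auto
      then show "\<exists>d. (gap_numer' has_real_derivative d) (at y) \<and> d \<le> 0"
        using gap_numer'_deriv [of y] y that a1 by auto
    qed
    then show ?thesis by (simp add: gap_numer'_def)
  qed
  have left: "gap_numer x \<le> 0" if "0 \<le> x" "x \<le> a" for x
  proof -
    have "gap_numer x \<le> gap_numer 0"
    proof (rule DERIV_nonpos_imp_nonincreasing [OF that(1)])
      fix y assume "0 \<le> y" "y \<le> x"
      then show "\<exists>d. (gap_numer has_real_derivative d) (at y) \<and> d \<le> 0"
        using gap_numer_deriv [of y] deriv_neg [of y] that a1 by auto
    qed
    then show ?thesis by (simp add: gap_numer_def)
  qed
  have conv: "convex_on {a..b} gap_numer"
  proof (rule f''_ge0_imp_convex)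
    fix x assume x: "x \<in> {a..b}"
    then show "(gap_numer has_real_derivative gap_numer' x) (at x)"
      using ab by (intro gap_numer_deriv) auto
    show "(gap_numer' has_real_derivative gap_cubic x / ((1 - x)\<^sup>2 * (1 + x)\<^sup>2)) (at x)"
      using ab x by (intro gap_numer'_deriv) auto
    show "0 \<le> gap_cubic x / ((1 - x)\<^sup>2 * (1 + x)\<^sup>2)"
      using pos x by auto
  qed simp
  have ka: "gap_numer a \<le> 0" using left ab by simp
  show ?thesis
  proof (rule that [OF ab(3,4)])
    fix x assume x: "0 \<le> x" "x \<le> gold"
    show "gap_numer x \<le> 0"
    proof (cases "x \<le> a")
      case True
      then show ?thesis using left x by simp
    next
      case False
      have "convex_on {a..gold} gap_numer"
        using conv by (rule convex_on_subset) (use ab in auto)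
      from convex_on_le_max [OF this, of x] show ?thesis
        using False x ka gap_numer_gold by auto
    qed
  next
    fix x assume x: "gold \<le> x" "x \<le> b"
    show "0 \<le> gap_numer x"
    proof (rule ccontr)
      assume "\<not> 0 \<le> gap_numer x"
      then have neg: "gap_numer x < 0" by simp
      \<comment> \<open>This weight puts \<open>gold\<close> on the segment from \<open>a\<close> to
        \<open>x\<close>; by convexity a negative value at \<open>x\<close> would make
        \<open>gap_numer gold\<close> negative.\<close>
      define t where "t = (gold - a) / (x - a)"
      have t: "0 < t" "t \<le> 1" using ab x by (auto simp: t_def field_simps)
      have "(1 - t) *\<^sub>R a + t *\<^sub>R x = gold"
      proof -
        have "x - a \<noteq> 0" using ab x by auto
        then have "t * (x - a) = gold - a" by (simp add: t_def)
        then show ?thesis by (simp add: algebra_simps)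
      qed
      then have "gap_numer gold \<le> (1 - t) * gap_numer a + t * gap_numer x"
        using convex_onD [OF conv, of t a x] t ab x by auto
      moreover have "(1 - t) * gap_numer a \<le> 0" "t * gap_numer x < 0"
        using t ka neg by (auto simp: mult_nonneg_nonpos mult_pos_neg)
      ultimately show False using gap_numer_gold by simp
    qed
  next
    show "convex_on {b..<1} (\<lambda>x. - gap_numer x)"
    proof (rule f''_ge0_imp_convex)
      fix x assume x: "x \<in> {b..<1}"
      then have x0: "0 \<le> x" "x < 1" using ab by auto
      show "((\<lambda>x. - gap_numer x) has_real_derivative - gap_numer' x) (at x)"
        using gap_numer_deriv [OF x0] by (intro derivative_intros)
      show "((\<lambda>x. - gap_numer' x) has_real_derivative - (gap_cubic x / ((1 - x)\<^sup>2 * (1 + x)\<^sup>2))) (at x)"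
        using gap_numer'_deriv [OF x0] by (intro derivative_intros)
      show "0 \<le> - (gap_cubic x / ((1 - x)\<^sup>2 * (1 + x)\<^sup>2))"
        using neg2 [of x] x by (auto intro!: divide_nonpos_nonneg)
    qed simp
  qed
qed

section \<open>The diagonal case of the entropy inequality\<close>

definition gap :: "real \<Rightarrow> real" where
  "gap x = gold * (bin_ent (x\<^sup>2) / x\<^sup>2) - bin_ent x / x"

lemma gap_deriv:
  assumes "0 < x" "x < 1"
  shows "(gap has_real_derivative gap_numer x / x ^ 3) (at x)"
proof -
  have x2: "0 < x\<^sup>2" "x\<^sup>2 < 1"
    using assms by (auto simp: power_less_one_iff)
  have "((\<lambda>x. bin_ent (x\<^sup>2) / x\<^sup>2) has_real_derivative ln (1 - x\<^sup>2) / (x\<^sup>2)\<^sup>2 * (2 * x)) (at x)"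
    using bin_ent_ratio_deriv [OF x2]
    by (rule DERIV_chain2) (auto intro!: derivative_eq_intros)
  then have "(gap has_real_derivative
      gold * (ln (1 - x\<^sup>2) / (x\<^sup>2)\<^sup>2 * (2 * x)) - ln (1 - x) / x\<^sup>2) (at x)"
    unfolding gap_def using bin_ent_ratio_deriv [OF assms]
    by (intro DERIV_diff DERIV_cmult)
  moreover have "ln (1 - x\<^sup>2) = ln (1 - x) + ln (1 + x)"
  proof -
    have "1 - x\<^sup>2 = (1 - x) * (1 + x)" by (simp add: power2_eq_square algebra_simps)
    then show ?thesis using assms by (simp add: ln_mult)
  qed
  ultimately show ?thesis
    using assms by (simp add: gap_numer_def field_simps power2_eq_square power3_eq_cube)
qed

text \<open>Entropy is symmetric under \<open>x \<mapsto> 1 - x\<close>, and squaring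
  \<open>gold\<close> is this reflection; hence the golden ratio.\<close>

lemma gap_gold: "gap gold = 0"
proof -
  have "bin_ent (gold\<^sup>2) = bin_ent gold"
    by (simp add: gold_sq bin_ent_def)
  then show ?thesis using gold_bounds by (simp add: gap_def power2_eq_square)
qed

lemma gap_tendsto_1: "(gap \<longlongrightarrow> 0) (at_left 1)"
  unfolding gap_def bin_ent_def by real_asymp

text \<open>\<open>gap\<close> falls to 0 at \<open>gold\<close>, then rises, and once it starts to
  fall again it falls towards its limit 0 at 1.\<close>

lemma gap_nonneg:
  assumes "0 < x" "x < 1"
  shows "0 \<le> gap x"
proof -
  obtain b where b: "gold < b" "b < 1"
    and neg: "\<And>x. 0 \<le> x \<Longrightarrow> x \<le> gold \<Longrightarrow> gap_numer x \<le> 0"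
    and pos: "\<And>x. gold \<le> x \<Longrightarrow> x \<le> b \<Longrightarrow> 0 \<le> gap_numer x"
    and conv: "convex_on {b..<1} (\<lambda>x. - gap_numer x)"
    using gap_numer_sign by blast
  have quasi: "min (gap_numer u) (gap_numer w) \<le> gap_numer v" if "b \<le> u" "u \<le> v" "v \<le> w" "w < 1" for u v w
  proof -
    have "convex_on {u..w} (\<lambda>x. - gap_numer x)"
      using conv by (rule convex_on_subset) (use that in auto)
    from convex_on_le_max [OF this, of v] show ?thesis using that by auto
  qed
  have decreasing: "gap v \<le> gap u"
    if "u \<le> v" "0 < u" "v < 1" "\<And>z. u \<le> z \<Longrightarrow> z \<le> v \<Longrightarrow> gap_numer z \<le> 0" for u v
  proof (rule DERIV_nonpos_imp_nonincreasing [OF that(1)])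
    fix z assume z: "u \<le> z" "z \<le> v"
    then have "gap_numer z / z ^ 3 \<le> 0"
      using that by (intro divide_nonpos_nonneg) auto
    then show "\<exists>d. (gap has_real_derivative d) (at z) \<and> d \<le> 0"
      using gap_deriv [of z] z that by auto
  qed
  \<comment> \<open>Splitting on the sign at \<open>x\<close> itself avoids the last zero of
    \<open>gap_numer\<close>: quasiconcavity spreads a nonnegative sign back to \<open>b\<close> and
    a negative one forward to 1.\<close>
  consider "x \<le> gold" | "gold \<le> x" "0 \<le> gap_numer x" | "b \<le> x" "gap_numer x < 0"
    using pos [of x] by fastforce
  then show ?thesis
  proof cases
    case 1
    then have "gap gold \<le> gap x"
      using assms b neg by (intro decreasing) auto
    then show ?thesis by (simp add: gap_gold)
  next
    case 2
    have "gap gold \<le> gap x"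
    proof (rule DERIV_nonneg_imp_nondecreasing [OF 2(1)])
      fix z assume z: "gold \<le> z" "z \<le> x"
      have "0 \<le> gap_numer z"
        using quasi [of b z x] pos [of z] pos [of b] z 2 b assms by fastforce
      then have "0 \<le> gap_numer z / z ^ 3" using z gold_bounds by auto
      then show "\<exists>d. (gap has_real_derivative d) (at z) \<and> 0 \<le> d"
        using gap_deriv [of z] z assms gold_bounds by auto
    qed
    then show ?thesis by (simp add: gap_gold)
  next
    case 3
    have "gap_numer z \<le> 0" if "x \<le> z" "z < 1" for z
      using quasi [of b x z] pos [of b] that 3 b by auto
    then have "gap z \<le> gap x" if "x \<le> z" "z < 1" for z
      using assms that by (intro decreasing) auto
    then have "\<forall>\<^sub>F z in at_left 1. gap z \<le> gap x"
      using assms by (intro eventually_at_leftI [of x]) auto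
    then show ?thesis
      using gap_tendsto_1 by (intro tendsto_upperbound) auto
  qed
qed

text \<open>Division by \<open>x * y\<close> turns the claim into G(x) + G(y) <= 2
  \<open>gold\<close> G(xy), which follows by passing through the geometric mean. If a factor is 1,
  it reduces to \<open>1 \<le> 2 * gold\<close>.\<close>

lemma bin_ent_mult_ge:
  assumes "0 \<le> x" "x \<le> 1" "0 \<le> y" "y \<le> 1"
  shows "x * bin_ent y + y * bin_ent x \<le> 2 * gold * bin_ent (x * y)"
proof -
  consider "x = 0 \<or> y = 0" | "x = 1 \<or> y = 1" | "0 < x" "x < 1" "0 < y" "y < 1"
    using assms by fastforce
  then show ?thesis
  proof cases
    case 1
    then show ?thesis by auto
  next
    case 2
    have "1 * bin_ent z \<le> 2 * gold * bin_ent z" if "0 \<le> z" "z \<le> 1" for z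
      using gold_bounds bin_ent_nonneg that by (intro mult_right_mono) auto
    with 2 show ?thesis using assms by auto
  next
    case 3
    define w where "w = sqrt (x * y)"
    have w: "0 < w" "w < 1" "w\<^sup>2 = x * y"
      using 3 mult_strict_mono [of x 1 y 1] by (auto simp: w_def)
    have "bin_ent x / x + bin_ent y / y \<le> 2 * (bin_ent w / w)"
      unfolding w_def using 3 by (rule bin_ent_ratio_geometric_mean)
    also have "\<dots> \<le> 2 * (gold * (bin_ent (x * y) / (x * y)))"
      using gap_nonneg [OF w(1,2)] w(3) by (simp add: gap_def)
    finally have "(x * y) * (bin_ent x / x + bin_ent y / y) \<le> (x * y) * (2 * (gold * (bin_ent (x * y) / (x * y))))"
      using 3 by (intro mult_left_mono) auto
    moreover have "(x * y) * (bin_ent x / x + bin_ent y / y) = x * bin_ent y + y * bin_ent x"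
      using 3 by (simp add: distrib_left)
    ultimately show ?thesis using 3 by simp
  qed
qed

subsection \<open>Entropy of maps on a finite set\<close>

lemma log_sum_inequality:
  fixes u n :: "'a \<Rightarrow> real"
  assumes "finite S" "\<And>s. s \<in> S \<Longrightarrow> 0 \<le> u s" "\<And>s. s \<in> S \<Longrightarrow> u s \<le> n s"
  shows "sum u S * ln (sum u S / sum n S) \<le> (\<Sum>s\<in>S. u s * ln (u s / n s))"
proof (cases "sum u S = 0")
  case True
  then have "u s = 0" if "s \<in> S" for s
    using sum_nonneg_eq_0_iff [of S u] assms that by auto
  then show ?thesis by simp
next
  case False
  then have U: "0 < sum u S" using sum_nonneg [of S u] assms by force
  moreover have "sum u S \<le> sum n S" using assms by (intro sum_mono) auto
  ultimately have N: "0 < sum n S" by simp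
  define c where "c = sum u S / sum n S"
  have c: "0 < c" using U N by (simp add: c_def)
  \<comment> \<open>This is \<open>ln t \<le> t - 1\<close> at \<open>t = n s * c / u s\<close>;
    with this \<open>c\<close> the terms \<open>u s - n s * c\<close> sum to zero.\<close>
  have "u s * ln c + u s - n s * c \<le> u s * ln (u s / n s)" if "s \<in> S" for s
  proof (cases "u s = 0")
    case True
    then show ?thesis using assms(3) [OF that] c by simp
  next
    case False
    then have pos: "0 < u s" "0 < n s" using assms(2,3) [OF that] by auto
    have "ln (n s * c / u s) \<le> n s * c / u s - 1"
      using pos c by (intro ln_le_minus_one) auto
    then have "u s * ln (n s * c / u s) \<le> u s * (n s * c / u s - 1)"
      using pos by (intro mult_left_mono) auto
    then show ?thesis
      using pos c by (simp add: ln_div ln_mult algebra_simps)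
  qed
  then have "(\<Sum>s\<in>S. u s * ln c + u s - n s * c) \<le> (\<Sum>s\<in>S. u s * ln (u s / n s))"
    by (intro sum_mono) auto
  also have "(\<Sum>s\<in>S. u s * ln c + u s - n s * c) = sum u S * ln c + sum u S - sum n S * c"
    by (simp add: sum.distrib sum_subtractf sum_distrib_right)
  also have "\<dots> = sum u S * ln (sum u S / sum n S)"
    using N by (simp add: c_def)
  finally show ?thesis .
qed

text \<open>Entropy weighted by block size, so that contributions of fibres add up without
  normalisation and an empty block contributes 0.\<close>

definition split_ent :: "real \<Rightarrow> real \<Rightarrow> real" where
  "split_ent u n = n * bin_ent (u / n)"

lemma split_ent_eq:
  "0 \<le> u \<Longrightarrow> u \<le> n \<Longrightarrow> split_ent u n = - (u * ln (u / n) + (n - u) * ln ((n - u) / n))"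
proof (cases "n = 0")
  case False
  then have "1 - u / n = (n - u) / n" by (simp add: field_simps)
  moreover have "n * - (u / n * a + (n - u) / n * b) = - (u * a + (n - u) * b)" for a b :: real
    using False by (simp add: field_simps)
  ultimately show ?thesis by (simp only: split_ent_def bin_ent_def)
qed (simp add: split_ent_def)

text \<open>The log-sum inequality applied to the parts \<open>u\<close> and to their complements
  \<open>n - u\<close>.\<close>

lemma split_ent_superadditive:
  assumes "finite S" "\<And>s. s \<in> S \<Longrightarrow> 0 \<le> u s" "\<And>s. s \<in> S \<Longrightarrow> u s \<le> n s"
  shows "(\<Sum>s\<in>S. split_ent (u s) (n s)) \<le> split_ent (sum u S) (sum n S)"
proof -
  have "sum u S * ln (sum u S / sum n S) \<le> (\<Sum>s\<in>S. u s * ln (u s / n s))"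
    using assms by (intro log_sum_inequality) auto
  moreover have "(\<Sum>s\<in>S. n s - u s) * ln ((\<Sum>s\<in>S. n s - u s) / sum n S)
      \<le> (\<Sum>s\<in>S. (n s - u s) * ln ((n s - u s) / n s))"
    using assms by (intro log_sum_inequality) auto
  moreover have "(\<Sum>s\<in>S. split_ent (u s) (n s)) =
      - (\<Sum>s\<in>S. u s * ln (u s / n s)) - (\<Sum>s\<in>S. (n s - u s) * ln ((n s - u s) / n s))"
    using assms by (simp add: split_ent_eq sum.distrib sum_negf sum_subtractf)
  moreover have "split_ent (sum u S) (sum n S) = - (sum u S * ln (sum u S / sum n S)) -
      (\<Sum>s\<in>S. n s - u s) * ln ((\<Sum>s\<in>S. n s - u s) / sum n S)"
    using assms by (subst split_ent_eq) (auto intro!: sum_nonneg sum_mono simp: sum_subtractf)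
  ultimately show ?thesis by simp
qed

lemma split_ent_mult_ge:
  assumes "0 \<le> u" "u \<le> n" "0 \<le> v" "v \<le> m"
  shows "u * split_ent v m + v * split_ent u n \<le> 2 * gold * split_ent (u * v) (n * m)"
proof -
  have "(n * m) * ((u / n) * bin_ent (v / m) + (v / m) * bin_ent (u / n))
      \<le> (n * m) * (2 * gold * bin_ent ((u / n) * (v / m)))"
    using assms by (intro mult_left_mono bin_ent_mult_ge) (auto simp: divide_le_eq_1)
  \<comment> \<open>This survives a zero denominator, since the bounds then force the numerator to
    be 0.\<close>
  moreover have "n * (u / n) = u" "m * (v / m) = v"
    using assms by (cases "n = 0"; cases "m = 0"; simp)+
  then have "(n * m) * ((u / n) * bin_ent (v / m) + (v / m) * bin_ent (u / n))
      = u * split_ent v m + v * split_ent u n"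
  proof -
    assume *: "n * (u / n) = u" "m * (v / m) = v"
    have "(n * m) * (a * B + b * A) = (n * a) * (m * B) + (m * b) * (n * A)" for a b A B :: real
      by (simp add: algebra_simps)
    then show ?thesis unfolding split_ent_def by (simp only: *)
  qed
  ultimately show ?thesis
    by (simp add: split_ent_def mult_ac)
qed

text \<open>
  For \<open>x\<close> uniform on \<open>X\<close>, the Shannon entropy of \<open>f x\<close> is \<open>ent X f / card X + ln (card X)\<close>, and the
  conditional entropy of \<open>P x\<close> given \<open>f x\<close> is \<open>cond_ent X f P / card X\<close>.
\<close>

definition ent :: "'a set \<Rightarrow> ('a \<Rightarrow> 'b) \<Rightarrow> real" where
  "ent X f = - (\<Sum>x\<in>X. ln (real (card {y \<in> X. f y = f x})))"

definition cond_ent :: "'a set \<Rightarrow> ('a \<Rightarrow> 'b) \<Rightarrow> ('a \<Rightarrow> bool) \<Rightarrow> real" where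
  "cond_ent X f P =
    (\<Sum>b\<in>f ` X. split_ent (card {y \<in> X. f y = b \<and> P y}) (card {y \<in> X. f y = b}))"

text \<open>Only the partition of \<open>X\<close> into fibres matters, so maps into different types
  can be exchanged.\<close>

lemma ent_cong:
  assumes "\<And>x y. x \<in> X \<Longrightarrow> y \<in> X \<Longrightarrow> f y = f x \<longleftrightarrow> g y = g x"
  shows "ent X f = ent X g"
proof -
  have "{y \<in> X. f y = f x} = {y \<in> X. g y = g x}" if "x \<in> X" for x
    using assms that by blast
  then show ?thesis unfolding ent_def by simp
qed

lemma ent_chain:
  assumes "finite X"
  shows "ent X (\<lambda>x. (f x, P x)) = ent X f + cond_ent X f P"
proof -
  define N where "N b = real (card {y \<in> X. f y = b})" for b
  define U where "U b = real (card {y \<in> X. f y = b \<and> P y})" for b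
  define V where "V b = real (card {y \<in> X. f y = b \<and> \<not> P y})" for b
  \<comment> \<open>The pointwise gain in information from learning \<open>P x\<close>; its sum over
    one fibre of \<open>f\<close> is the \<open>split_ent\<close> of that fibre.\<close>
  define g where "g x = ln (real (card {y \<in> X. f y = f x}))
      - ln (real (card {y \<in> X. (f y, P y) = (f x, P x)}))" for x
  have NUV: "N b = U b + V b" for b
  proof -
    have "{y \<in> X. f y = b} = {y \<in> X. f y = b \<and> P y} \<union> {y \<in> X. f y = b \<and> \<not> P y}" by auto
    then have "card {y \<in> X. f y = b} = card {y \<in> X. f y = b \<and> P y} + card {y \<in> X. f y = b \<and> \<not> P y}"
      using assms by (simp add: card_Un_disjoint disjoint_iff)
    then show ?thesis by (simp add: N_def U_def V_def)
  qed
  have "sum g {x \<in> X. f x = b} = split_ent (U b) (N b)" for b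
  proof -
    have eq: "{x \<in> X. f x = b} = {x \<in> X. f x = b \<and> P x} \<union> {x \<in> X. f x = b \<and> \<not> P x}" by auto
    have "sum g {x \<in> X. f x = b} = sum g {x \<in> X. f x = b \<and> P x} + sum g {x \<in> X. f x = b \<and> \<not> P x}"
      unfolding eq using assms by (intro sum.union_disjoint) auto
    also have "sum g {x \<in> X. f x = b \<and> P x} = (\<Sum>x\<in>{x \<in> X. f x = b \<and> P x}. ln (N b) - ln (U b))"
      by (intro sum.cong) (auto simp: g_def N_def U_def)
    also have "\<dots> = U b * (ln (N b) - ln (U b))"
      by (simp add: U_def)
    also have "sum g {x \<in> X. f x = b \<and> \<not> P x} = (\<Sum>x\<in>{x \<in> X. f x = b \<and> \<not> P x}. ln (N b) - ln (V b))"
      by (intro sum.cong) (auto simp: g_def N_def V_def)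
    also have "\<dots> = V b * (ln (N b) - ln (V b))"
      by (simp add: V_def)
    also have "U b * (ln (N b) - ln (U b)) + V b * (ln (N b) - ln (V b)) = split_ent (U b) (N b)"
    proof -
      have "0 \<le> U b" "0 \<le> V b" by (simp_all add: U_def V_def)
      then show ?thesis
        by (cases "U b = 0"; cases "V b = 0") (simp_all add: split_ent_eq NUV ln_div algebra_simps)
    qed
    finally show ?thesis .
  qed
  then have "sum g X = cond_ent X f P"
    using sum.image_gen [OF assms, of g f] by (simp add: cond_ent_def U_def N_def)
  then show ?thesis by (simp add: ent_def g_def sum_subtractf)
qed

lemma cond_ent_nonneg:
  assumes "finite X"
  shows "0 \<le> cond_ent X f P"
  unfolding cond_ent_def split_ent_def using assms
  by (intro sum_nonneg mult_nonneg_nonneg bin_ent_nonneg)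
    (auto simp: divide_le_eq_1 card_gt_0_iff intro!: card_mono)

text \<open>Groups fine fibres into a coarse one; a constant \<open>r\<close> gives the count over
  all of \<open>X\<close>.\<close>

lemma card_fibre_sum:
  assumes "finite X"
  shows "(\<Sum>c\<in>{c \<in> g ` X. r c = b}. card {y \<in> X. g y = c \<and> P y}) = card {y \<in> X. r (g y) = b \<and> P y}"
proof -
  have "(\<Sum>c\<in>{c \<in> g ` X. r c = b}. \<Sum>y\<in>{y \<in> {y \<in> X. r (g y) = b \<and> P y}. g y = c}. 1::nat)
      = (\<Sum>y\<in>{y \<in> X. r (g y) = b \<and> P y}. 1)"
    using assms by (intro sum.group) auto
  moreover have "{y \<in> {y \<in> X. r (g y) = b \<and> P y}. g y = c} = {y \<in> X. g y = c \<and> P y}"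
    if "r c = b" for c
    using that by auto
  ultimately show ?thesis by simp
qed

text \<open>Conditioning on less information cannot lower entropy: merging fibres is
  superadditive.\<close>

lemma cond_ent_refine:
  assumes "finite X"
  shows "cond_ent X g P \<le> cond_ent X (\<lambda>x. r (g x)) P"
proof -
  define u where "u c = real (card {y \<in> X. g y = c \<and> P y})" for c
  define n where "n c = real (card {y \<in> X. g y = c})" for c
  have "cond_ent X g P = (\<Sum>c\<in>g ` X. split_ent (u c) (n c))"
    by (simp add: cond_ent_def u_def n_def)
  also have "\<dots> = (\<Sum>b\<in>r ` g ` X. \<Sum>c\<in>{c \<in> g ` X. r c = b}. split_ent (u c) (n c))"
    using assms by (intro sum.image_gen) auto
  also have "\<dots> \<le> (\<Sum>b\<in>r ` g ` X. split_ent (sum u {c \<in> g ` X. r c = b}) (sum n {c \<in> g ` X. r c = b}))"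
    using assms by (intro sum_mono split_ent_superadditive) (auto simp: u_def n_def intro!: card_mono)
  also have "\<dots> = cond_ent X (\<lambda>x. r (g x)) P"
  proof -
    have "sum u {c \<in> g ` X. r c = b} = card {y \<in> X. r (g y) = b \<and> P y}" for b
      unfolding u_def card_fibre_sum [OF assms, symmetric] by simp
    moreover have "sum n {c \<in> g ` X. r c = b} = card {y \<in> X. r (g y) = b}" for b
      unfolding n_def using card_fibre_sum [OF assms, where P = "\<lambda>_. True"]
      by (simp flip: of_nat_sum)
    ultimately show ?thesis by (simp add: cond_ent_def image_image)
  qed
  finally show ?thesis .
qed

text \<open>Independence of the two draws is encoded by the product \<open>X \<times> X\<close>,
  whose fibre counts multiply, so \<open>split_ent_mult_ge\<close> can be summed over pairs of
  fibres.\<close>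

lemma cond_ent_pair_ge:
  assumes "finite X"
  shows "card {x \<in> X. P x} * cond_ent X f P
    \<le> gold * cond_ent (X \<times> X) (\<lambda>(x, y). (f x, f y)) (\<lambda>(x, y). P x \<and> P y)"
proof -
  define u where "u b = real (card {y \<in> X. f y = b \<and> P y})" for b
  define n where "n b = real (card {y \<in> X. f y = b})" for b
  define K where "K b = split_ent (u b) (n b)" for b
  have un: "0 \<le> u b" "u b \<le> n b" for b
    using assms by (auto simp: u_def n_def intro!: card_mono)
  have sumu: "sum u (f ` X) = card {x \<in> X. P x}"
  proof -
    have "(\<Sum>b\<in>f ` X. card {y \<in> X. f y = b \<and> P y}) = card {x \<in> X. P x}"
      using card_fibre_sum [OF assms, where g = f and r = "\<lambda>_. ()" and b = "()" and P = P] by simp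
    then show ?thesis unfolding u_def by (simp flip: of_nat_sum)
  qed
  have sumK: "sum K (f ` X) = cond_ent X f P"
    by (simp add: K_def u_def n_def cond_ent_def)
  have img: "(\<lambda>(x, y). (f x, f y)) ` (X \<times> X) = f ` X \<times> f ` X"
    by auto
  have cardu: "real (card {z \<in> X \<times> X. (case z of (x, y) \<Rightarrow> (f x, f y)) = (a, b) \<and> (case z of (x, y) \<Rightarrow> P x \<and> P y)})
      = u a * u b" for a b
  proof -
    have "{z \<in> X \<times> X. (case z of (x, y) \<Rightarrow> (f x, f y)) = (a, b) \<and> (case z of (x, y) \<Rightarrow> P x \<and> P y)}
        = {y \<in> X. f y = a \<and> P y} \<times> {y \<in> X. f y = b \<and> P y}" by auto
    then show ?thesis by (simp add: u_def card_cartesian_product)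
  qed
  have cardn: "real (card {z \<in> X \<times> X. (case z of (x, y) \<Rightarrow> (f x, f y)) = (a, b)}) = n a * n b" for a b
  proof -
    have "{z \<in> X \<times> X. (case z of (x, y) \<Rightarrow> (f x, f y)) = (a, b)}
        = {y \<in> X. f y = a} \<times> {y \<in> X. f y = b}" by auto
    then show ?thesis by (simp add: n_def card_cartesian_product)
  qed
  \<comment> \<open>Symmetrising matches the two-term left side of the inequality and cancels its
    factor 2.\<close>
  have "2 * (sum u (f ` X) * sum K (f ` X)) = (\<Sum>a\<in>f ` X. \<Sum>b\<in>f ` X. u a * K b + u b * K a)"
  proof -
    have "(\<Sum>a\<in>f ` X. \<Sum>b\<in>f ` X. u b * K a) = (\<Sum>a\<in>f ` X. \<Sum>b\<in>f ` X. u a * K b)"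
      by (rule sum.swap)
    then show ?thesis by (simp add: sum.distrib sum_product)
  qed
  also have "\<dots> \<le> (\<Sum>a\<in>f ` X. \<Sum>b\<in>f ` X. 2 * gold * split_ent (u a * u b) (n a * n b))"
    unfolding K_def using un by (intro sum_mono split_ent_mult_ge) auto
  also have "\<dots> = 2 * gold * cond_ent (X \<times> X) (\<lambda>(x, y). (f x, f y)) (\<lambda>(x, y). P x \<and> P y)"
  proof -
    have "cond_ent (X \<times> X) (\<lambda>(x, y). (f x, f y)) (\<lambda>(x, y). P x \<and> P y)
        = (\<Sum>(a, b)\<in>f ` X \<times> f ` X. split_ent (u a * u b) (n a * n b))"
      unfolding cond_ent_def img
    proof (rule sum.cong)
      fix c assume "c \<in> f ` X \<times> f ` X"
      obtain a b where c: "c = (a, b)" by (cases c)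
      show "split_ent
          (card {z \<in> X \<times> X. (case z of (x, y) \<Rightarrow> (f x, f y)) = c \<and> (case z of (x, y) \<Rightarrow> P x \<and> P y)})
          (card {z \<in> X \<times> X. (case z of (x, y) \<Rightarrow> (f x, f y)) = c})
        = (case c of (a, b) \<Rightarrow> split_ent (u a * u b) (n a * n b))"
        unfolding c cardu cardn by simp
    qed simp
    then show ?thesis by (simp add: sum_distrib_left sum.cartesian_product case_prod_unfold)
  qed
  finally show ?thesis by (simp add: sumu sumK)
qed

section \<open>Extremal values of the entropy\<close>

lemma ent_const: "ent X (\<lambda>x. c) = - (card X * ln (card X))"
  by (simp add: ent_def)

lemma ent_inj_on:
  assumes "inj_on f X"
  shows "ent X f = 0"
proof -
  have "{y \<in> X. f y = f x} = {x}" if "x \<in> X" for x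
    using assms that by (auto simp: inj_on_def)
  then show ?thesis by (simp add: ent_def)
qed

text \<open>The unnormalised form of the bound of entropy by the logarithm of the number of values,
  from the log-sum inequality with constant weights \<open>card X\<close>.\<close>

lemma ent_le_card_image:
  assumes "finite X" "finite Y" "f ` X \<subseteq> Y"
  shows "ent X f \<le> - (card X * ln (card X / card Y))"
proof (cases "X = {}")
  case True
  then show ?thesis by (simp add: ent_def)
next
  case False
  define M where "M b = real (card {x \<in> X. f x = b})" for b
  have sumM: "sum M (f ` X) = card X"
  proof -
    have "(\<Sum>b\<in>f ` X. card {x \<in> X. f x = b}) = card X"
      using card_fibre_sum [OF assms(1), where g = f and r = "\<lambda>_. ()" and b = "()" and P = "\<lambda>_. True"] by simp
    then show ?thesis unfolding M_def by (simp flip: of_nat_sum)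
  qed
  have "ent X f = - (\<Sum>x\<in>X. ln (M (f x)))"
    by (simp add: ent_def M_def)
  also have "(\<Sum>x\<in>X. ln (M (f x))) = (\<Sum>b\<in>f ` X. M b * ln (M b))"
    by (subst sum.image_gen [OF assms(1), of _ f]) (simp add: M_def)
  finally have eq: "ent X f = - (\<Sum>b\<in>f ` X. M b * ln (M b))" .
  have "real (card X) * ln (card X / (card X * card (f ` X)))
     \<le> (\<Sum>b\<in>f ` X. M b * ln (M b / card X))"
    using log_sum_inequality [of "f ` X" M "\<lambda>_. card X"] assms sumM
    by (simp add: M_def card_mono mult.commute)
  also have "\<dots> = (\<Sum>b\<in>f ` X. M b * ln (M b) - M b * ln (card X))"
  proof (rule sum.cong)
    fix b assume "b \<in> f ` X"
    then have "M b > 0" using assms by (auto simp: M_def card_gt_0_iff)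
    then show "M b * ln (M b / card X) = M b * ln (M b) - M b * ln (card X)"
      using False assms by (simp add: ln_div algebra_simps card_gt_0_iff)
  qed simp
  also have "\<dots> = - ent X f - card X * ln (card X)"
    by (simp add: eq sum_subtractf sumM flip: sum_distrib_right)
  finally have "ent X f \<le> - (card X * ln (card X)) + card X * ln (card (f ` X))"
    using False assms by (simp add: ln_div ln_mult card_gt_0_iff algebra_simps)
  also have "\<dots> \<le> - (card X * ln (card X)) + card X * ln (card Y)"
  proof -
    have "card (f ` X) \<le> card Y" "0 < card (f ` X)"
      using False assms by (auto intro!: card_mono simp: card_gt_0_iff)
    then show ?thesis by (intro add_left_mono mult_left_mono) auto
  qed
  also have "\<dots> = - (card X * ln (card X / card Y))"
    using False assms by (subst ln_div) (auto simp: card_gt_0_iff algebra_simps)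
  finally show ?thesis .
qed

subsection \<open>Union-closed families\<close>

text \<open>The chain rule for revealing \<open>j\<close>. The event is avoidance because a union
  avoids \<open>j\<close> exactly when both sets do.\<close>

lemma ent_restrict_insert:
  assumes "finite X"
  shows "ent X (\<lambda>x. h x \<inter> insert j I) = ent X (\<lambda>x. h x \<inter> I) + cond_ent X (\<lambda>x. h x \<inter> I) (\<lambda>x. j \<notin> h x)"
proof -
  have "ent X (\<lambda>x. h x \<inter> insert j I) = ent X (\<lambda>x. (h x \<inter> insert j I, j \<notin> h x))"
    by (rule ent_cong) auto
  also have "\<dots> = ent X (\<lambda>x. (h x \<inter> I, j \<notin> h x))"
    by (rule ent_cong) auto
  finally show ?thesis using ent_chain [OF assms] by simp
qed

lemma ent_union_step:
  assumes "finite F"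
  shows "card {S \<in> F. j \<notin> S} * (ent F (\<lambda>S. S \<inter> insert j I) - ent F (\<lambda>S. S \<inter> I))
    \<le> gold * (ent (F \<times> F) (\<lambda>(S, T). (S \<union> T) \<inter> insert j I) - ent (F \<times> F) (\<lambda>(S, T). (S \<union> T) \<inter> I))"
proof -
  have "card {S \<in> F. j \<notin> S} * cond_ent F (\<lambda>S. S \<inter> I) (\<lambda>S. j \<notin> S)
      \<le> gold * cond_ent (F \<times> F) (\<lambda>(S, T). (S \<inter> I, T \<inter> I)) (\<lambda>(S, T). j \<notin> S \<and> j \<notin> T)"
    using assms by (rule cond_ent_pair_ge)
  \<comment> \<open>The pair of traces determines the trace of the union; the composite is spelled
    out to fit \<open>cond_ent_refine\<close>.\<close>
  also have "\<dots> \<le> gold * cond_ent (F \<times> F) (\<lambda>z. (\<lambda>(A, B). A \<union> B) ((\<lambda>(S, T). (S \<inter> I, T \<inter> I)) z))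
      (\<lambda>(S, T). j \<notin> S \<and> j \<notin> T)"
    using assms gold_bounds by (intro mult_left_mono cond_ent_refine) auto
  also have "\<dots> = gold * cond_ent (F \<times> F) (\<lambda>(S, T). (S \<union> T) \<inter> I) (\<lambda>(S, T). j \<notin> S \<union> T)"
    by (simp add: case_prod_unfold Int_Un_distrib2)
  finally show ?thesis
    using assms ent_restrict_insert [of F "\<lambda>S. S" j I]
      ent_restrict_insert [of "F \<times> F" "\<lambda>(S, T). S \<union> T" j I]
    by (simp add: case_prod_unfold)
qed

text \<open>The one-element steps telescope; nonnegative increments allow each avoidance count to be
  replaced by \<open>d\<close>. Subtracting the constant map makes the empty case trivial.\<close>

lemma ent_union_lower_bound:
  fixes F :: "'a set set" and d :: real
  assumes "finite F" "finite I" and d: "\<And>j. j \<in> I \<Longrightarrow> d \<le> card {S \<in> F. j \<notin> S}"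
  shows "d * (ent F (\<lambda>S. S \<inter> I) - ent F (\<lambda>S. {} :: 'a set))
    \<le> gold * (ent (F \<times> F) (\<lambda>(S, T). (S \<union> T) \<inter> I) - ent (F \<times> F) (\<lambda>z. {} :: 'a set))"
  using assms(2) d
proof (induction I rule: finite_induct)
  case empty
  then show ?case by (simp add: case_prod_unfold)
next
  case (insert j I)
  have "0 \<le> ent F (\<lambda>S. S \<inter> insert j I) - ent F (\<lambda>S. S \<inter> I)"
    using ent_restrict_insert [OF assms(1), of "\<lambda>S. S" j I]
      cond_ent_nonneg [OF assms(1), of "\<lambda>S. S \<inter> I" "\<lambda>S. j \<notin> S"] by simp
  then have "d * (ent F (\<lambda>S. S \<inter> insert j I) - ent F (\<lambda>S. S \<inter> I))
      \<le> card {S \<in> F. j \<notin> S} * (ent F (\<lambda>S. S \<inter> insert j I) - ent F (\<lambda>S. S \<inter> I))"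
    using insert.prems by (intro mult_right_mono) auto
  moreover have "d * (ent F (\<lambda>S. S \<inter> I) - ent F (\<lambda>S. {} :: 'a set))
      \<le> gold * (ent (F \<times> F) (\<lambda>(S, T). (S \<union> T) \<inter> I) - ent (F \<times> F) (\<lambda>z. {} :: 'a set))"
    using insert.prems by (intro insert.IH) auto
  ultimately show ?case
    using ent_union_step [OF assms(1), of j I] by (simp add: algebra_simps)
qed

lemma union_closed_few_avoiding:
  fixes F :: "'a set set"
  assumes "union_closed F" "F \<subseteq> Pow I" "finite I" "I \<noteq> {}" "2 \<le> card F"
  shows "\<exists>i\<in>I. card {S \<in> F. i \<notin> S} \<le> gold * card F"
proof (rule ccontr)
  assume "\<not> ?thesis"
  then have many: "gold * card F < card {S \<in> F. i \<notin> S}" if "i \<in> I" for i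
    using that by force
  have fin: "finite F" using assms finite_subset by blast
  define m where "m = real (card F)"
  have m: "2 \<le> m" using assms by (simp add: m_def)
  \<comment> \<open>Finiteness of \<open>I\<close> keeps the inequality strict for one common
    bound.\<close>
  define d where "d = real (Min ((\<lambda>i. card {S \<in> F. i \<notin> S}) ` I))"
  have "Min ((\<lambda>i. card {S \<in> F. i \<notin> S}) ` I) \<in> (\<lambda>i. card {S \<in> F. i \<notin> S}) ` I"
    using assms by (intro Min_in) auto
  then have d: "gold * m < d" using many by (auto simp: d_def m_def)
  have restrict: "S \<inter> I = S" if "S \<in> F" for S
    using assms that by auto
  have "inj_on (\<lambda>S. S \<inter> I) F" using restrict by (simp add: inj_on_def)
  then have E: "ent F (\<lambda>S. S \<inter> I) = 0" by (rule ent_inj_on)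
  \<comment> \<open>Union-closedness enters here: the union takes at most \<open>m\<close> values,
    which caps its entropy at \<open>ln m\<close>.\<close>
  have "(\<lambda>(S, T). (S \<union> T) \<inter> I) ` (F \<times> F) \<subseteq> F"
    using assms(1) restrict by (auto simp: union_closed_def Int_Un_distrib2)
  then have "ent (F \<times> F) (\<lambda>(S, T). (S \<union> T) \<inter> I) \<le> - (m * m * ln (m * m / m))"
    using ent_le_card_image [of "F \<times> F" F] fin by (simp add: card_cartesian_product m_def)
  then have "ent (F \<times> F) (\<lambda>(S, T). (S \<union> T) \<inter> I) - ent (F \<times> F) (\<lambda>z. {} :: 'a set) \<le> m * m * ln m"
    using m by (simp add: ent_const card_cartesian_product ln_mult algebra_simps flip: m_def)
  then have "gold * (ent (F \<times> F) (\<lambda>(S, T). (S \<union> T) \<inter> I) - ent (F \<times> F) (\<lambda>z. {} :: 'a set)) \<le> gold * (m * m * ln m)"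
    using gold_bounds by (intro mult_left_mono) auto
  moreover have "d * (ent F (\<lambda>S. S \<inter> I) - ent F (\<lambda>S. {} :: 'a set))
      \<le> gold * (ent (F \<times> F) (\<lambda>(S, T). (S \<union> T) \<inter> I) - ent (F \<times> F) (\<lambda>z. {} :: 'a set))"
    using fin assms by (intro ent_union_lower_bound) (auto simp: d_def)
  ultimately have "d * (m * ln m) \<le> gold * m * (m * ln m)"
    by (simp add: E ent_const flip: m_def)
  \<comment> \<open>As \<open>2 \<le> m\<close>, the factor \<open>m * ln m\<close> is positive and
    cancels, contradicting \<open>gold * m < d\<close>.\<close>
  then show False using d m by simp
qed

theorem theorem1:
  fixes n :: nat and F :: "nat set set"
  assumes "n \<ge> 1"
    and "F \<subseteq> Pow {1..n}"
    and "F \<noteq> {}"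
    and "F \<noteq> {{}}"
    and "union_closed F"
  shows "\<exists>i\<in>{1..n}. real (card {S \<in> F. i \<in> S}) \<ge> (3 - sqrt 5) / 2 * real (card F)"
proof -
  have fin: "finite F" using assms(2) finite_subset by blast
  show ?thesis
  \<comment> \<open>A single-member family has zero entropy and is treated directly: its member is
    nonempty, and any element of it works.\<close>
  proof (cases "2 \<le> card F")
    case True
    obtain i where i: "i \<in> {1..n}" "card {S \<in> F. i \<notin> S} \<le> gold * card F"
      using union_closed_few_avoiding [OF assms(5,2) _ _ True] assms(1) by fastforce
    have "F = {S \<in> F. i \<in> S} \<union> {S \<in> F. i \<notin> S}" by auto
    then have "card F = card {S \<in> F. i \<in> S} + card {S \<in> F. i \<notin> S}"
      using fin card_Un_disjoint [of "{S \<in> F. i \<in> S}" "{S \<in> F. i \<notin> S}"] by fastforce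
    moreover have "(3 - sqrt 5) / 2 * card F = card F - gold * card F"
      by (simp add: gold_def field_simps)
    ultimately have "(3 - sqrt 5) / 2 * card F \<le> card {S \<in> F. i \<in> S}"
      using i(2) by simp
    with i(1) show ?thesis by blast
  next
    case False
    moreover have "0 < card F" using fin assms(3) by (simp add: card_gt_0_iff)
    ultimately have "card F = 1" by linarith
    then obtain S where S: "F = {S}" by (auto simp: card_1_singleton_iff)
    then obtain i where i: "i \<in> S" "i \<in> {1..n}" using assms(2,4) by blast
    then have "{T \<in> F. i \<in> T} = F" using S by auto
    moreover have "1 \<le> sqrt 5" by simp
    then have "(3 - sqrt 5) / 2 \<le> 1" by simp
    ultimately show ?thesis using i(2) S by (intro bexI [of _ i]) auto
  qed
qed

end
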